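(* Let $d\geqslant 1$ be an integer. For every integer $\ell\geqslant 0$ and every real $p\geqslant 0$ there exists a radial kernel $K$ on $\mathbb{R}^d$ which is infinitely differentiable, has finite moments $\int_{\mathbb{R}^d}|\mathbf{u}|^j|K(\mathbf{u})|\,\mathrm{d}\mathbf{u}<\infty$ for $j=0,\ldots,\ell$, and decays at infinity not faster than $|\mathbf{u}|^{-p}$ (that is, $\limsup_{|\mathbf{u}|\to\infty}|\mathbf{u}|^{p}|K(\mathbf{u})|>0$), with the following property. For any non-negative measurable function $f_0$ on the unit ball $\{|\mathbf{u}|\leqslant 1\}$ with $\int_{|\mathbf{u}|\leqslant 1}f_0(\mathbf{u})\,\mathrm{d}\mathbf{u}<1$, let $$\mathcal{F}=\{f \text{ a probability density on } \mathbb{R}^d:\ f(\mathbf{u})=f_0(\mathbf{u})\ \text{ for all } \mathbf{u} \text{ with } |\mathbf{u}|\leqslant 1\}.$$ Then, as $h\to 0$ over invertible real $d\times d$ matrices, $$\sup_{f\in\mathcal{F}}\,(K_h\star f)(\mathbf{0})=\Omega(1)\cdot\frac{|\lambda_1|^{p}}{\prod_{i=1}^{d}|\lambda_i|},$$ where $\lambda_1,\ldots,\lambda_d$ are the eigenvalues of $h$ (with multiplicity), ordered so that $|\lambda_1|\geqslant\ldots\geqslant|\lambda_d|$. Explicitly: there are constants $c>0$ and $\eta>0$, not depending on $h$, such that for every invertible $h$ with $\|h\|\leqslant\eta$ the left-hand side is at least $c\,|\lambda_1|^{p}/\prod_{i=1}^d|\lambda_i|$.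
   Context: A kernel on $\mathbb{R}^d$ is a real-valued integrable function $K:\mathbb{R}^d\to\mathbb{R}$; it is radial if $K(\mathbf{u})=k(|\mathbf{u}|)$ for a function $k$ of one real variable. Here $|\mathbf{u}|$ is the Euclidean norm of a vector and $\|h\|$ is the induced operator norm of a matrix. For an invertible real $d\times d$ matrix $h$ (the bandwidth), the rescaled kernel is $K_h(\mathbf{u})=|h|^{-1}K(h^{-1}\mathbf{u})$, where $|h|$ denotes the absolute value of the determinant of $h$. The convolution is $(K_h\star f)(\mathbf{x}')=\int_{\mathbb{R}^d}K_h(\mathbf{x}'-\mathbf{x})f(\mathbf{x})\,\mathrm{d}\mathbf{x}$. *)

theory Defs
  imports
    "HOL-Analysis.Analysis"
    "HOL-Computational_Algebra.Computational_Algebra"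
begin

section \<open>Infinitely differentiable functions\<close>

text \<open>
  \<open>C_n n f\<close>: all iterated directional derivatives of order at most \<open>n\<close> exist, the derivatives of
  order less than \<open>n\<close> being Frechet differentiable everywhere and those of order \<open>n\<close> continuous.
\<close>
primrec C_n :: "nat \<Rightarrow> ('a::real_normed_vector \<Rightarrow> 'b::real_normed_vector) \<Rightarrow> bool" where
  "C_n 0 f \<longleftrightarrow> continuous_on UNIV f"
| "C_n (Suc n) f \<longleftrightarrow>
     (\<forall>x. f differentiable (at x)) \<and> (\<forall>v. C_n n (\<lambda>x. frechet_derivative f (at x) v))"

definition infinitely_differentiable ::
    "('a::real_normed_vector \<Rightarrow> 'b::real_normed_vector) \<Rightarrow> bool" where
  "infinitely_differentiable f \<longleftrightarrow> (\<forall>n. C_n n f)"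


section \<open>Kernels, densities and convolution\<close>

definition kernel :: "(real^'d \<Rightarrow> real) \<Rightarrow> bool" where
  "kernel K \<longleftrightarrow> integrable lebesgue K"

definition radial :: "(real^'d \<Rightarrow> real) \<Rightarrow> bool" where
  "radial K \<longleftrightarrow> (\<exists>k :: real \<Rightarrow> real. \<forall>u. K u = k (norm u))"

definition rescaled :: "real^'d^'d \<Rightarrow> (real^'d \<Rightarrow> real) \<Rightarrow> real^'d \<Rightarrow> real" where
  "rescaled h K u = K (matrix_inv h *v u) / \<bar>det h\<bar>"

text \<open>
  The Bochner integral is \<open>0\<close> where \<open>x \<mapsto> g (y - x) * f x\<close> is not integrable, so a positive value
  of \<open>convolve g f y\<close> is always that of a genuine integral.
\<close>
definition convolve :: "(real^'d \<Rightarrow> real) \<Rightarrow> (real^'d \<Rightarrow> real) \<Rightarrow> real^'d \<Rightarrow> real" where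
  "convolve g f y = (LINT x|lebesgue. g (y - x) * f x)"

definition probability_density :: "(real^'d \<Rightarrow> real) \<Rightarrow> bool" where
  "probability_density f \<longleftrightarrow>
     f \<in> borel_measurable lebesgue \<and> (\<forall>u. 0 \<le> f u) \<and> (\<integral>\<^sup>+u. ennreal (f u) \<partial>lebesgue) = 1"

definition densities_extending :: "(real^'d \<Rightarrow> real) \<Rightarrow> (real^'d \<Rightarrow> real) set" where
  "densities_extending f0 = {f. probability_density f \<and> (\<forall>u. norm u \<le> 1 \<longrightarrow> f u = f0 u)}"


section \<open>Eigenvalues\<close>

definition charpoly :: "'a::comm_ring_1^'n^'n \<Rightarrow> 'a poly" where
  "charpoly A = det (mat [:0, 1:] - (\<chi> i j. [:A $ i $ j:]))"

text \<open>The complex eigenvalues of a real matrix, counted with algebraic multiplicity.\<close>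
definition eigenvalues :: "real^'n^'n \<Rightarrow> complex multiset" where
  "eigenvalues h = proots (charpoly (\<chi> i j. complex_of_real (h $ i $ j)))"

text \<open>
  Sanity checks: there are exactly \<open>CARD('n)\<close> eigenvalues, and they are the scalars that admit a nonzero
  complex eigenvector.
\<close>
lemma charpoly_monic:
  fixes A :: "'a::idom^'n^'n"
  shows "degree (charpoly A) = CARD('n)" "lead_coeff (charpoly A) = 1"
proof -
  let ?M = "mat [:0, 1:] - (\<chi> i j. [:A $ i $ j:]) :: 'a poly^'n^'n"
  let ?P = "{p. p permutes (UNIV :: 'n set)}"
  let ?t = "\<lambda>p. of_int (sign p) * (\<Prod>i\<in>UNIV. ?M $ i $ p i)"
  let ?D = "\<Prod>i\<in>(UNIV :: 'n set). [:- (A $ i $ i), 1:]"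
  have fin: "finite ?P" by (simp add: finite_permutations)
  have entry: "?M $ i $ j = (if i = j then [:- (A $ i $ i), 1:] else [:- (A $ i $ j):])" for i j
    by (simp add: mat_def)
  have degD: "degree ?D = CARD('n)"
    by (subst degree_prod_eq_sum_degree) auto
  have lcD: "lead_coeff ?D = 1"
    by (simp add: lead_coeff_prod)
  have small: "degree (?t p) < CARD('n)" if "p \<in> ?P - {id}" for p
  proof -
    from that have i: "\<exists>i. i \<noteq> p i" by (metis (mono_tags) DiffE eq_id_iff singletonI)
    have "degree (?t p) \<le> degree (\<Prod>i\<in>UNIV. ?M $ i $ p i)"
      by (cases rule: sign_cases[of p]) (simp_all add: degree_minus)
    also have "\<dots> \<le> (\<Sum>i\<in>UNIV. degree (?M $ i $ p i))"
      using degree_prod_sum_le[of UNIV "\<lambda>i. ?M $ i $ p i"] by (simp add: o_def)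
    also have "\<dots> < (\<Sum>i\<in>(UNIV :: 'n set). 1)"
      using i by (intro sum_strict_mono_ex1) (auto simp: entry simp del: vector_minus_component)
    finally show ?thesis by simp
  qed
  have "charpoly A = sum ?t ?P" by (simp add: charpoly_def det_def)
  also have "\<dots> = ?t id + sum ?t (?P - {id})"
    by (rule sum.remove[OF fin]) (simp add: permutes_id)
  also have "?t id = ?D" by (simp add: entry del: vector_minus_component)
  finally have eq: "charpoly A = ?D + sum ?t (?P - {id})" .
  have less: "degree (sum ?t (?P - {id})) < degree ?D"
    unfolding degD by (rule degree_sum_less[OF small]) auto
  show "degree (charpoly A) = CARD('n)"
    unfolding eq by (simp only: degree_add_eq_left[OF less] degD)
  show "lead_coeff (charpoly A) = 1"
    unfolding eq using less lcD degD
    by (simp only: add.commute[of ?D] lead_coeff_add_le)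
qed

lemma size_eigenvalues: "size (eigenvalues (h :: real^'n^'n)) = CARD('n)"
  by (simp add: eigenvalues_def size_proots_complex charpoly_monic)

lemma poly_det: "poly (det M) z = det (\<chi> i j. poly (M $ i $ j) z)"
  for M :: "'a::comm_ring_1 poly^'n^'n"
proof -
  have s: "poly (of_int (sign p)) z = of_int (sign p)" for p :: "'n \<Rightarrow> 'n"
    by (cases rule: sign_cases[of p]) simp_all
  show ?thesis by (simp add: det_def poly_sum poly_prod s)
qed

lemma eigenvalues_iff:
  fixes h :: "real^'n^'n"
  shows "z \<in># eigenvalues h \<longleftrightarrow>
    (\<exists>v :: complex^'n. v \<noteq> 0 \<and> (\<chi> i j. complex_of_real (h $ i $ j)) *v v = z *s v)"
proof -
  let ?A = "\<chi> i j. complex_of_real (h $ i $ j)"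
  have nz: "charpoly ?A \<noteq> 0"
    using charpoly_monic(2)[of ?A] by auto
  have M: "(\<chi> i j. poly ((mat [:0, 1:] - (\<chi> i j. [:?A $ i $ j:])) $ i $ j) z) = mat z - ?A"
    by (simp add: vec_eq_iff mat_def)
  have "z \<in># eigenvalues h \<longleftrightarrow> poly (charpoly ?A) z = 0"
    unfolding eigenvalues_def using nz by simp
  also have "\<dots> \<longleftrightarrow> det (mat z - ?A) = 0"
    by (simp only: charpoly_def poly_det M)
  also have "\<dots> \<longleftrightarrow> \<not> invertible (mat z - ?A)"
    by (simp add: invertible_det_nz)
  also have "\<dots> \<longleftrightarrow> (\<exists>v. v \<noteq> 0 \<and> (mat z - ?A) *v v = 0)"
    using matrix_left_invertible_ker[of "mat z - ?A"] by (auto simp: invertible_left_inverse)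
  also have "\<dots> \<longleftrightarrow> (\<exists>v. v \<noteq> 0 \<and> ?A *v v = z *s v)"
  proof -
    have "mat z *v v = z *s v" for v :: "complex^'n"
      by (simp add: vec_eq_iff matrix_vector_mult_def mat_def if_distrib[where f = "\<lambda>x. x * _"]
            cong: if_cong)
    thus ?thesis by (auto simp: matrix_vector_mult_diff_rdistrib)
  qed
  finally show ?thesis .
qed

end

theory Submission
  imports Defs
begin

text \<open>
  A kernel with many finite moments need not tend to zero. Write \<open>s = u \<bullet> u\<close> and take
  \<open>K u = 1 / (1 + (1 + s) ^ (3 * k) * sin s ^ 2)\<close>. It equals \<open>1\<close> on every sphere
  \<open>s = n * pi\<close> (a ridge), and far out it is tiny except near these spheres. The ridges occur at
  arbitrarily large radii, so \<open>|u| powr p * K u\<close> does not tend to \<open>0\<close> for any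
  \<open>p \<ge> 0\<close>; but the ridge at \<open>s = n * pi\<close> narrows at least as fast as \<open>n ^ (-k)\<close>, so a
  large exponent \<open>k\<close> makes any prescribed number of moments finite
  (\<open>ridge_kernel_moments\<close>).

  For an invertible \<open>h\<close>, the function \<open>x \<mapsto> K (matrix_inv h *v (- x))\<close> takes the value \<open>1\<close> at some point
  outside the unit ball: \<open>h\<close> stretches vectors of a fixed direction by a fixed positive factor, and
  there are ridges as far out as one likes. By continuity it exceeds \<open>1/2\<close> on a bounded nonempty open
  set \<open>U\<close> outside the unit ball. The density that agrees with \<open>f0\<close> on the ball and spreads the
  remaining mass \<open>1 - I\<close>, where \<open>I\<close> is the integral of \<open>f0\<close>, evenly over \<open>U\<close> then has a
  convolution of at least \<open>(1 - I) / 2 / |det h|\<close> at the origin (\<open>ex_density_convolve_ge\<close>).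

  The product of the moduli of the eigenvalues is \<open>|det h|\<close> (\<open>prod_eigenvalues\<close>), and every
  eigenvalue has modulus at most the operator norm (\<open>norm_eigenvalue_le_onorm\<close>). So if the
  operator norm is at most \<open>1\<close>, then \<open>|\<lambda>\<^sub>1| powr p \<le> 1\<close>, and the claim holds with
  \<open>c = (1 - I) / 2\<close> and \<open>\<eta> = 1\<close>.
\<close>

section \<open>Smoothness\<close>

text \<open>
  A class of expressions that contains the kernel and is closed under directional derivatives, which
  are exactly the derivatives that \<open>C_n\<close> iterates. Smoothness of all members follows at once,
  without computing any higher derivative.
\<close>
inductive elementary :: "('a::euclidean_space \<Rightarrow> real) \<Rightarrow> bool" where
  const: "elementary (\<lambda>_. c)"
| linear: "elementary (\<lambda>u. u \<bullet> b)"
| square: "elementary (\<lambda>u. u \<bullet> u)"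
| add: "elementary f \<Longrightarrow> elementary g \<Longrightarrow> elementary (\<lambda>u. f u + g u)"
| mult: "elementary f \<Longrightarrow> elementary g \<Longrightarrow> elementary (\<lambda>u. f u * g u)"
| sin: "elementary f \<Longrightarrow> elementary (\<lambda>u. sin (f u))"
| cos: "elementary f \<Longrightarrow> elementary (\<lambda>u. cos (f u))"
| inverse: "elementary f \<Longrightarrow> (\<And>u. f u \<noteq> 0) \<Longrightarrow> elementary (\<lambda>u. inverse (f u))"

lemma elementary_power: "elementary f \<Longrightarrow> elementary (\<lambda>u. f u ^ n)"
  by (induction n) (auto intro: elementary.intros)

text \<open>
  The sum, product, chain and quotient rules only produce expressions built by the same operations.
\<close>
lemma elementary_has_derivative:
  assumes "elementary f"
  shows "\<exists>f'. (\<forall>x. (f has_derivative f' x) (at x)) \<and> (\<forall>v. elementary (\<lambda>x. f' x v))"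
  using assms
proof induction
  case (const c)
  show ?case
    by (rule exI[of _ "\<lambda>_ _. 0"]) (auto intro: elementary.const)
next
  case (linear b)
  show ?case
    by (rule exI[of _ "\<lambda>_ v. v \<bullet> b"])
       (auto intro: elementary.const bounded_linear.has_derivative bounded_linear_inner_left)
next
  case square
  have "elementary (\<lambda>x. 2 * (x \<bullet> v))" for v :: 'a
    by (intro elementary.intros)
  thus ?case
    by (intro exI[of _ "\<lambda>x v. 2 * (x \<bullet> v)"])
       (auto intro!: derivative_eq_intros simp: inner_commute)
next
  case (add f g)
  then obtain f' g' where
    d: "\<And>x. (f has_derivative f' x) (at x)" "\<And>x. (g has_derivative g' x) (at x)"
    and e: "\<And>v. elementary (\<lambda>x. f' x v)" "\<And>v. elementary (\<lambda>x. g' x v)" by blast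
  show ?case
    by (rule exI[of _ "\<lambda>x v. f' x v + g' x v"])
       (auto intro: elementary.add e has_derivative_add d)
next
  case (mult f g)
  then obtain f' g' where
    d: "\<And>x. (f has_derivative f' x) (at x)" "\<And>x. (g has_derivative g' x) (at x)"
    and e: "\<And>v. elementary (\<lambda>x. f' x v)" "\<And>v. elementary (\<lambda>x. g' x v)" by blast
  show ?case
    by (rule exI[of _ "\<lambda>x v. f x * g' x v + f' x v * g x"])
       (auto intro!: elementary.add elementary.mult e has_derivative_mult d mult.hyps)
next
  case (sin f)
  then obtain f' where
    d: "\<And>x. (f has_derivative f' x) (at x)" and e: "\<And>v. elementary (\<lambda>x. f' x v)" by blast
  show ?case
    by (rule exI[of _ "\<lambda>x v. f' x v * cos (f x)"])
       (auto intro!: elementary.mult elementary.cos e d has_derivative_sin sin.hyps)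
next
  case (cos f)
  then obtain f' where
    d: "\<And>x. (f has_derivative f' x) (at x)" and e: "\<And>v. elementary (\<lambda>x. f' x v)" by blast
  have "elementary (\<lambda>x. f' x v * (- 1 * sin (f x)))" for v
    by (intro elementary.intros e cos.hyps)
  thus ?case
    by (intro exI[of _ "\<lambda>x v. f' x v * - sin (f x)"])
       (use has_derivative_cos[OF d] in auto)
next
  case (inverse f)
  then obtain f' where
    d: "\<And>x. (f has_derivative f' x) (at x)" and e: "\<And>v. elementary (\<lambda>x. f' x v)" by blast
  have "elementary (\<lambda>x. - 1 * (inverse (f x) * f' x v * inverse (f x)))" for v
    by (intro elementary.intros e inverse.hyps)
  thus ?case
    by (intro exI[of _ "\<lambda>x v. - (inverse (f x) * f' x v * inverse (f x))"])
       (use Deriv.has_derivative_inverse[OF inverse.hyps(2) d] e in auto)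
qed

lemma elementary_C_n: "elementary f \<Longrightarrow> C_n n f"
proof (induction n arbitrary: f)
  case 0
  then obtain f' where "\<And>x. (f has_derivative f' x) (at x)"
    using elementary_has_derivative by blast
  thus ?case
    by (auto intro!: continuous_at_imp_continuous_on has_derivative_continuous)
next
  case (Suc n)
  then obtain f' where d: "\<And>x. (f has_derivative f' x) (at x)"
    and e: "\<And>v. elementary (\<lambda>x. f' x v)"
    using elementary_has_derivative by blast
  have "frechet_derivative f (at x) = f' x" for x
    using frechet_derivative_at[OF d] by simp
  moreover have "f differentiable (at x)" for x using d by (rule differentiableI)
  ultimately show ?case using Suc.IH e by simp
qed

section \<open>The kernel\<close>

text \<open>
  The exponent \<open>3 * k\<close> is chosen so that \<open>(1 + s) ^ (3 * k) * sin s ^ 2\<close> exceeds \<open>(1 + s) ^ k\<close> as soon as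
  \<open>|sin s|\<close> exceeds \<open>(1 + s) ^ (- k)\<close>: two of the three powers pay for the square of the sine, and the third
  one is the decay.
\<close>
definition ridge_kernel :: "nat \<Rightarrow> 'a::euclidean_space \<Rightarrow> real" where
  "ridge_kernel k u = inverse (1 + (1 + u \<bullet> u) ^ (3 * k) * sin (u \<bullet> u) ^ 2)"

lemma ridge_denominator_ge_1: "1 + (1 + u \<bullet> u) ^ k * sin (u \<bullet> u) ^ 2 \<ge> (1::real)"
  for u :: "'a::euclidean_space"
  by simp

lemma ridge_kernel_pos: "ridge_kernel k u > 0"
  unfolding ridge_kernel_def using ridge_denominator_ge_1[of u "3 * k"]
  by (intro positive_imp_inverse_positive) linarith

lemma ridge_kernel_le_1: "ridge_kernel k u \<le> 1"
  unfolding ridge_kernel_def by (rule inverse_le_1_iff[THEN iffD2]) simp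

lemma ridge_kernel_on_ridge:
  assumes "u \<bullet> u = real n * pi"
  shows "ridge_kernel k u = 1"
  by (simp add: ridge_kernel_def assms)

lemma elementary_ridge_kernel: "elementary (ridge_kernel k :: 'a::euclidean_space \<Rightarrow> real)"
proof -
  have "1 + (1 + u \<bullet> u) ^ (3 * k) * sin (u \<bullet> u) ^ 2 \<noteq> 0" for u :: 'a
    using ridge_denominator_ge_1[of u "3 * k"] by linarith
  thus ?thesis
    unfolding ridge_kernel_def [abs_def]
    by (intro elementary.intros elementary_power)
qed

lemma smooth_ridge_kernel: "infinitely_differentiable (ridge_kernel k :: 'a::euclidean_space \<Rightarrow> real)"
  by (simp add: infinitely_differentiable_def elementary_C_n elementary_ridge_kernel)

lemma continuous_ridge_kernel: "continuous_on UNIV (ridge_kernel k :: 'a::euclidean_space \<Rightarrow> real)"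
  using elementary_C_n[OF elementary_ridge_kernel, of 0] by simp

section \<open>Moments\<close>

text \<open>
  The form in which a moment is compared with a series: near the ridges the sets are thin shells, and
  elsewhere they are balls.
\<close>
lemma nn_integral_finite_by_cover:
  fixes c m :: "nat \<Rightarrow> real"
  assumes S: "\<And>n. S n \<in> sets M" "\<And>n. emeasure M (S n) \<le> ennreal (m n)"
    and nonneg: "\<And>n. 0 \<le> c n"
    and sum: "summable (\<lambda>n. c n * m n)"
    and cover: "\<And>x. x \<in> T \<Longrightarrow> \<exists>n. x \<in> S n \<and> g x \<le> c n"
    and m: "\<And>n. 0 \<le> m n"
  shows "(\<integral>\<^sup>+x. ennreal (g x) * indicator T x \<partial>M) < \<infinity>"
proof -
  have "(\<integral>\<^sup>+x. ennreal (g x) * indicator T x \<partial>M)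
      \<le> (\<integral>\<^sup>+x. (\<Sum>n. ennreal (c n) * indicator (S n) x) \<partial>M)"
  proof (rule nn_integral_mono)
    fix x
    show "ennreal (g x) * indicator T x \<le> (\<Sum>n. ennreal (c n) * indicator (S n) x)"
    proof (cases "x \<in> T")
      case True
      then obtain n where n: "x \<in> S n" "g x \<le> c n" using cover by blast
      have "ennreal (g x) \<le> ennreal (c n) * indicator (S n) x"
        using n by (simp add: ennreal_leI)
      also have "\<dots> \<le> (\<Sum>n. ennreal (c n) * indicator (S n) x)"
        using sum_le_suminf[OF summableI, of "{n}" "\<lambda>n. ennreal (c n) * indicator (S n) x"]
        by (simp del: sum_mult_indicator)
      finally show ?thesis using True by simp
    qed simp
  qed
  also have "\<dots> = (\<Sum>n. \<integral>\<^sup>+x. ennreal (c n) * indicator (S n) x \<partial>M)"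
    using S(1) by (intro nn_integral_suminf) auto
  also have "\<dots> = (\<Sum>n. ennreal (c n) * emeasure M (S n))"
    using S(1) by (simp add: nn_integral_cmult_indicator)
  also have "\<dots> \<le> (\<Sum>n. ennreal (c n * m n))"
    using S(2) nonneg by (intro suminf_le) (auto simp: ennreal_mult' intro: mult_left_mono)
  also have "\<dots> < \<infinity>"
    using sum nonneg m by (simp add: suminf_ennreal2)
  finally show ?thesis .
qed

lemma power_diff_le_linear:
  fixes r R :: real
  assumes "0 \<le> r" "r \<le> R"
  shows "R ^ n - r ^ n \<le> real n * R ^ (n - 1) * (R - r)"
proof (induction n)
  case (Suc n)
  have "R ^ Suc n - r ^ Suc n = R * (R ^ n - r ^ n) + r ^ n * (R - r)"
    by (simp add: algebra_simps)
  also have "\<dots> \<le> R * (real n * R ^ (n - 1) * (R - r)) + R ^ n * (R - r)"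
    using assms Suc by (intro add_mono mult_left_mono mult_right_mono power_mono) auto
  also have "\<dots> = real (Suc n) * R ^ n * (R - r)"
    by (cases n) (auto simp: algebra_simps)
  finally show ?case by simp
qed simp

text \<open>
  The measure is \<open>R ^ d - r ^ d\<close> times the volume of the unit ball, where \<open>R\<close> and \<open>r\<close> are the square
  roots of \<open>b\<close> and \<open>a\<close>. The point of the bound is that it is linear in \<open>b - a\<close>; this uses
  \<open>R - r \<le> (R - r) * (R + r) = b - a\<close>, valid because \<open>R \<ge> 1\<close>.
\<close>
lemma emeasure_shell_le:
  fixes a b :: real
  assumes "0 \<le> a" "a \<le> b" "1 \<le> b"
  defines "d \<equiv> DIM('a::euclidean_space)"
  shows "emeasure lborel {u :: 'a. a \<le> u \<bullet> u \<and> u \<bullet> u \<le> b}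
       \<le> ennreal (unit_ball_vol d * (real d * b ^ d * (b - a)))"
proof -
  let ?r = "sqrt a" and ?R = "sqrt b"
  have rR: "0 \<le> ?r" "?r \<le> ?R" "1 \<le> ?R" using assms by auto
  have "{u :: 'a. a \<le> u \<bullet> u \<and> u \<bullet> u \<le> b} = cball 0 ?R - ball 0 ?r"
    by (auto simp: norm_eq_sqrt_inner not_less)
  also have "emeasure lborel \<dots> = emeasure lborel (cball (0::'a) ?R) - emeasure lborel (ball (0::'a) ?r)"
    using rR by (intro emeasure_Diff) (auto simp: emeasure_ball simp del: real_sqrt_le_iff)
  also have "\<dots> = ennreal (unit_ball_vol d * (?R ^ d - ?r ^ d))"
    using rR assms by (simp add: emeasure_ball emeasure_cball ennreal_minus right_diff_distrib)
  also have "\<dots> \<le> ennreal (unit_ball_vol d * (real d * b ^ d * (b - a)))"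
  proof (intro ennreal_leI mult_left_mono)
    have "?R ^ d - ?r ^ d \<le> real d * ?R ^ (d - 1) * (?R - ?r)"
      by (rule power_diff_le_linear) (use rR in auto)
    also have "\<dots> \<le> real d * b ^ d * (b - a)"
    proof (intro mult_mono mult_nonneg_nonneg)
      have "?R ^ (d - 1) \<le> ?R ^ (2 * d)" using rR by (intro power_increasing) auto
      thus "?R ^ (d - 1) \<le> b ^ d" using assms by (simp add: power_mult)
      have "(?R - ?r) * 1 \<le> (?R - ?r) * (?R + ?r)"
        using rR by (intro mult_left_mono) linarith+
      hence "?R - ?r \<le> (?R - ?r) * (?R + ?r)" by (simp only: mult_1_right)
      also have "\<dots> = b - a" using assms by (simp add: algebra_simps)
      finally show "?R - ?r \<le> b - a" .
    qed (use rR assms in auto)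
    finally show "?R ^ d - ?r ^ d \<le> real d * b ^ d * (b - a)" .
  qed simp
  finally show ?thesis .
qed

text \<open>
  The error of the linear Taylor polynomial is at most \<open>|x| ^ 3 / 6 \<le> 2 / 3 * |x|\<close>, since \<open>|x| \<le> 2\<close>.
\<close>
lemma abs_le_3_abs_sin:
  fixes x :: real
  assumes "\<bar>x\<bar> \<le> pi / 2"
  shows "\<bar>x\<bar> \<le> 3 * \<bar>sin x\<bar>"
proof -
  have "\<bar>sin x - (\<Sum>m<3. sin_coeff m * x ^ m)\<bar> \<le> inverse (fact 3) * \<bar>x\<bar> ^ 3"
    by (rule Maclaurin_sin_bound)
  hence "\<bar>sin x - x\<bar> \<le> \<bar>x\<bar> ^ 3 / 6"
    by (simp add: eval_nat_numeral sin_coeff_def divide_simps)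
  also have "\<bar>x\<bar> ^ 3 / 6 \<le> \<bar>x\<bar> * 4 / 6"
  proof -
    have "\<bar>x\<bar> \<le> 2" using assms pi_less_4 by linarith
    hence "\<bar>x\<bar> ^ 2 \<le> 2 ^ 2" by (intro power_mono) auto
    hence "\<bar>x\<bar> * \<bar>x\<bar> ^ 2 \<le> \<bar>x\<bar> * 4" by (intro mult_left_mono) auto
    thus ?thesis by (simp add: power3_eq_cube power2_eq_square)
  qed
  finally show ?thesis by linarith
qed

text \<open>
  The integer \<open>n\<close> is \<open>s / pi\<close> rounded to the nearest one. A small \<open>|sin s|\<close> puts \<open>s\<close> close to the ridge
  \<open>n * pi\<close>, and \<open>n\<close> and \<open>s\<close> are comparable, so bounds in terms of \<open>s\<close> become terms of a series in \<open>n\<close>.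
\<close>
lemma near_multiple_of_pi:
  fixes s :: real
  assumes "0 \<le> s"
  obtains n :: nat where "\<bar>s - real n * pi\<bar> \<le> 3 * \<bar>sin s\<bar>" "real n \<le> s" "s \<le> 4 * real n + 2"
proof -
  define n where "n = nat \<lfloor>s / pi + 1 / 2\<rfloor>"
  have n: "real n \<le> s / pi + 1 / 2" "s / pi + 1 / 2 < real n + 1"
    using assms by (auto simp: n_def)
  hence n': "real n * pi \<le> s + pi / 2" "s < real n * pi + pi / 2"
    by (auto simp: field_simps)
  have close: "\<bar>s - real n * pi\<bar> \<le> pi / 2" using n' by linarith
  have "\<bar>sin (s - real n * pi)\<bar> = \<bar>sin s\<bar>"
    by (simp add: sin_diff abs_mult)
  hence 1: "\<bar>s - real n * pi\<bar> \<le> 3 * \<bar>sin s\<bar>"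
    using abs_le_3_abs_sin[OF close] by simp
  have 2: "real n \<le> s"
  proof (cases n)
    case (Suc m)
    have "real n * 3 \<le> real n * pi" using pi_gt3 by (intro mult_left_mono) auto
    thus ?thesis using n' pi_less_4 Suc by simp
  qed (use assms in auto)
  have "real n * pi \<le> real n * 4" using pi_less_4 by (intro mult_left_mono) auto
  hence 3: "s \<le> 4 * real n + 2" using n' pi_less_4 by linarith
  show ?thesis using that 1 2 3 by blast
qed

lemma summable_inverse_Suc_sq: "summable (\<lambda>n. C / (1 + real n) ^ 2)"
proof -
  have "summable (\<lambda>n. inverse (real n ^ 2))"
    using inverse_power_summable[of 2, where 'a = real] by simp
  hence "summable (\<lambda>n. inverse (real (Suc n) ^ 2))" by (subst summable_Suc_iff)
  from summable_mult[OF this, of C] show ?thesis by (simp add: field_simps)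
qed

text \<open>
  Split the space at \<open>|sin s| = (1 + s) ^ (- k)\<close>. Where the sine is larger, \<open>K\<close> is at most
  \<open>(1 + s) ^ (- k)\<close>, and for \<open>n \<le> s < n + 1\<close> the integrand is at most \<open>(1 + n) ^ (- d - 2)\<close> on a ball of
  volume at most \<open>V * (1 + n) ^ d\<close>. Where it is smaller, the point lies in a shell
  \<open>|s - n * pi| \<le> 3 / (1 + n) ^ k\<close>; there \<open>K \<le> 1\<close>, and the weight and the volume grow like
  \<open>(1 + n) ^ l\<close> and \<open>(1 + n) ^ d\<close> times the width. In both cases the value \<open>k = l + d + 2\<close> leaves the summable
  \<open>(1 + n) ^ (- 2)\<close>.
\<close>
lemma ridge_kernel_moment_finite:
  fixes l :: nat
  defines "k \<equiv> l + DIM('a::euclidean_space) + 2"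
  defines "g \<equiv> \<lambda>u :: 'a. (1 + u \<bullet> u) ^ l * ridge_kernel k u"
  shows "(\<integral>\<^sup>+u. ennreal (g u) \<partial>lborel) < \<infinity>"
proof -
  define d where "d = DIM('a)"
  define V where "V = unit_ball_vol (real d)"
  have V: "V \<ge> 0" by (simp add: V_def)
  define T where "T = {u :: 'a. \<bar>sin (u \<bullet> u)\<bar> * (1 + u \<bullet> u) ^ k \<le> 1}"
  have T: "T \<in> sets lborel"
    unfolding T_def by measurable
  have g_meas: "g \<in> borel_measurable borel"
    unfolding g_def
    by (intro borel_measurable_continuous_onI continuous_intros continuous_ridge_kernel)

  (* far from the ridges: balls indexed by the integer part of s, as K decays like a power of s *)
  have off: "(\<integral>\<^sup>+u. ennreal (g u) * indicator (- T) u \<partial>lborel) < \<infinity>"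
  proof (rule nn_integral_finite_by_cover)
    let ?S = "\<lambda>n::nat. cball (0::'a) (sqrt (1 + real n))"
    let ?c = "\<lambda>n::nat. 1 / (1 + real n) ^ (d + 2)" and ?m = "\<lambda>n::nat. V * (1 + real n) ^ d"
    show "?S n \<in> sets lborel" for n by simp
    show "emeasure lborel (?S n) \<le> ennreal (?m n)" for n
    proof -
      have "sqrt (1 + real n) ^ d \<le> sqrt (1 + real n) ^ (2 * d)"
        by (intro power_increasing) auto
      also have "\<dots> = (1 + real n) ^ d" by (simp add: power_mult)
      finally show ?thesis
        using V by (simp add: emeasure_cball d_def[symmetric] V_def ennreal_leI mult_left_mono)
    qed
    have "?c n * ?m n = V / (1 + real n) ^ 2" for n
      by (simp add: power_add power2_eq_square)
    thus "summable (\<lambda>n. ?c n * ?m n)" by (simp only: summable_inverse_Suc_sq)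
    fix u :: 'a assume "u \<in> - T"
    define s where "s = u \<bullet> u"
    have s: "0 \<le> s" by (simp add: s_def)
    have "1 < \<bar>sin s\<bar> * (1 + s) ^ k" using \<open>u \<in> - T\<close> by (simp add: T_def s_def)
    hence "1 \<le> (\<bar>sin s\<bar> * (1 + s) ^ k) ^ 2" by simp
    also have "\<dots> = sin s ^ 2 * ((1 + s) ^ k) ^ 2" by (simp add: power_mult_distrib)
    finally have "(1 + s) ^ k * 1 \<le> (1 + s) ^ k * (sin s ^ 2 * ((1 + s) ^ k) ^ 2)"
      using s by (intro mult_left_mono) auto
    also have "\<dots> = (1 + s) ^ (3 * k) * sin s ^ 2"
      by (simp add: power_mult power3_eq_cube power2_eq_square power_commutes mult_ac
          flip: power_mult_distrib)
    finally have K: "ridge_kernel k u \<le> inverse ((1 + s) ^ k)"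
      unfolding ridge_kernel_def s_def[symmetric] using s by (intro le_imp_inverse_le) auto
    define n where "n = nat \<lfloor>s\<rfloor>"
    have n: "real n \<le> s" "s < real n + 1" using s by (auto simp: n_def)
    have "g u \<le> (1 + s) ^ l * inverse ((1 + s) ^ k)"
      unfolding g_def s_def[symmetric] using s K by (intro mult_left_mono) auto
    also have "\<dots> = inverse ((1 + s) ^ (d + 2))"
      using s by (simp add: k_def d_def[symmetric] power_add)
    also have "\<dots> \<le> ?c n"
      unfolding inverse_eq_divide using s n by (intro divide_left_mono power_mono) auto
    finally have "g u \<le> ?c n" .
    moreover have "u \<in> ?S n"
      using n by (simp add: norm_eq_sqrt_inner s_def[symmetric])
    ultimately show "\<exists>n. u \<in> ?S n \<and> g u \<le> ?c n" by blast
  qed (use V in auto)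

  (* near the ridges: thin shells; the max with 0 keeps the shell n = 0 in the range of u . u *)
  have on: "(\<integral>\<^sup>+u. ennreal (g u) * indicator T u \<partial>lborel) < \<infinity>"
  proof (rule nn_integral_finite_by_cover)
    let ?D = "\<lambda>n::nat. 3 / (1 + real n) ^ k"
    let ?a = "\<lambda>n. max 0 (real n * pi - ?D n)" and ?b = "\<lambda>n. real n * pi + ?D n"
    let ?S = "\<lambda>n. {u :: 'a. ?a n \<le> u \<bullet> u \<and> u \<bullet> u \<le> ?b n}"
    let ?c = "\<lambda>n::nat. (4 * (1 + real n)) ^ l"
    let ?m = "\<lambda>n::nat. V * (real d * (4 * (1 + real n)) ^ d * (2 * ?D n))"
    show "?S n \<in> sets lborel" for n by measurable
    show "emeasure lborel (?S n) \<le> ennreal (?m n)" for n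
    proof -
      have D: "0 \<le> ?D n" "?D n \<le> 3" by (auto simp: divide_le_eq)
      have b1: "1 \<le> ?b n"
      proof (cases n)
        case (Suc j)
        have "1 * 1 \<le> real n * pi" using Suc pi_gt3 by (intro mult_mono) auto
        thus ?thesis using D by linarith
      qed simp
      have "real n * pi \<le> real n * 4" using pi_less_4 by (intro mult_left_mono) auto
      hence "?b n \<le> real n * 4 + 3" using D(2) by (rule add_mono)
      hence b4: "?b n \<le> 4 * (1 + real n)" by simp
      have ab: "?a n \<le> ?b n" "?b n - ?a n \<le> 2 * ?D n" using D b1 by auto
      have "emeasure lborel (?S n) \<le> ennreal (V * (real d * ?b n ^ d * (?b n - ?a n)))"
        unfolding V_def d_def by (rule emeasure_shell_le) (use ab b1 in auto)
      also have "\<dots> \<le> ennreal (?m n)"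
        using V ab b1 b4 by (intro ennreal_leI mult_left_mono mult_mono power_mono) auto
      finally show ?thesis .
    qed
    have "?c n * ?m n = (4 ^ l * V * d * 4 ^ d * 6) / (1 + real n) ^ 2" for n
    proof -
      have e: "(1 + real n) ^ k = (1 + real n) ^ l * (1 + real n) ^ d * (1 + real n) ^ 2"
        by (simp add: k_def d_def power_add power2_eq_square)
      have "x * y * z \<noteq> 0 \<Longrightarrow> (A * x) * (V * (real d * (B * y) * (2 * (3 / (x * y * z)))))
          = (A * V * d * B * 6) / z" for x y z A B :: real
        by (simp add: field_simps)
      from this[of "(1 + real n) ^ l" "(1 + real n) ^ d" "(1 + real n) ^ 2" "4 ^ l" "4 ^ d"]
      show ?thesis unfolding e power_mult_distrib by simp
    qed
    thus "summable (\<lambda>n. ?c n * ?m n)"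
      by (simp only: summable_inverse_Suc_sq)
    fix u :: 'a assume "u \<in> T"
    define s where "s = u \<bullet> u"
    have s: "0 \<le> s" by (simp add: s_def)
    obtain n where n: "\<bar>s - real n * pi\<bar> \<le> 3 * \<bar>sin s\<bar>" "real n \<le> s" "s \<le> 4 * real n + 2"
      using near_multiple_of_pi[OF s] .
    have "\<bar>sin s\<bar> * (1 + real n) ^ k \<le> \<bar>sin s\<bar> * (1 + s) ^ k"
      using n by (intro mult_left_mono power_mono) auto
    also have "\<dots> \<le> 1" using \<open>u \<in> T\<close> by (simp add: T_def s_def)
    finally have "3 * \<bar>sin s\<bar> \<le> ?D n" by (simp add: field_simps)
    hence "u \<in> ?S n" using n s unfolding s_def[symmetric] by (auto simp: s_def[symmetric])
    moreover have "g u \<le> ?c n"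
    proof -
      have "g u \<le> (1 + s) ^ l * 1"
        unfolding g_def s_def[symmetric] using s
        by (intro mult_left_mono ridge_kernel_le_1) auto
      also have "\<dots> \<le> ?c n" using n s by (simp add: power_mono)
      finally show ?thesis .
    qed
    ultimately show "\<exists>n. u \<in> ?S n \<and> g u \<le> ?c n" by blast
  qed (use V in auto)

  have "(\<integral>\<^sup>+u. ennreal (g u) \<partial>lborel)
      = (\<integral>\<^sup>+u. ennreal (g u) * indicator T u + ennreal (g u) * indicator (- T) u \<partial>lborel)"
    by (intro nn_integral_cong) (auto split: split_indicator)
  also have "\<dots> = (\<integral>\<^sup>+u. ennreal (g u) * indicator T u \<partial>lborel)
      + (\<integral>\<^sup>+u. ennreal (g u) * indicator (- T) u \<partial>lborel)"
    using T g_meas by (intro nn_integral_add) auto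
  also have "\<dots> < \<infinity>" using on off by simp
  finally show ?thesis .
qed

text \<open>
  The weight \<open>(1 + s) ^ l\<close> dominates all powers of the norm up to \<open>l\<close>, because \<open>|u| \<le> 1 + |u|\<^sup>2\<close>.
\<close>
lemma ridge_kernel_moments:
  fixes l :: nat
  defines "k \<equiv> l + DIM('a::euclidean_space) + 2"
  assumes "j \<le> l"
  shows "integrable lebesgue (\<lambda>u :: 'a. norm u ^ j * ridge_kernel k u)"
proof -
  let ?f = "\<lambda>u :: 'a. norm u ^ j * ridge_kernel k u"
  have meas: "?f \<in> borel_measurable borel"
    by (intro borel_measurable_continuous_onI continuous_intros continuous_ridge_kernel)
  have "integrable lborel ?f"
  proof (rule integrableI_bounded)
    have "norm (?f u) \<le> (1 + u \<bullet> u) ^ l * ridge_kernel k u" for u :: 'a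
    proof -
      have "2 * norm u \<le> 1 + norm u ^ 2"
        using zero_le_power2[of "norm u - 1"] by (simp add: power2_diff)
      hence "norm u \<le> 1 + u \<bullet> u"
        using norm_ge_zero[of u] unfolding power2_norm_eq_inner by linarith
      hence "norm u ^ j \<le> (1 + u \<bullet> u) ^ j" by (intro power_mono) auto
      also have "\<dots> \<le> (1 + u \<bullet> u) ^ l" using assms by (intro power_increasing) auto
      finally show ?thesis
        using ridge_kernel_pos[of k u] by (simp add: abs_mult mult_right_mono)
    qed
    note bound = this
    have "(\<integral>\<^sup>+u. ennreal (norm (?f u)) \<partial>lborel)
        \<le> (\<integral>\<^sup>+u. ennreal ((1 + u \<bullet> u) ^ l * ridge_kernel k (u :: 'a)) \<partial>lborel)"
      by (intro nn_integral_mono ennreal_leI bound)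
    also have "\<dots> < \<infinity>"
      unfolding k_def by (rule ridge_kernel_moment_finite)
    finally show "(\<integral>\<^sup>+u. ennreal (norm (?f u)) \<partial>lborel) < \<infinity>" .
  qed (use meas in simp)
  thus ?thesis using meas by (simp add: integrable_completion)
qed

lemma ridge_vector:
  obtains u :: "'a::euclidean_space" where "u \<bullet> u = real n * pi"
proof -
  obtain v :: 'a where "norm v = sqrt (real n * pi)"
    using vector_choose_size[of "sqrt (real n * pi)"] by auto
  hence "v \<bullet> v = real n * pi" by (simp add: flip: power2_norm_eq_inner)
  thus ?thesis using that by blast
qed

lemma Limsup_ridge_kernel_pos:
  assumes "p \<ge> 0"
  shows "Limsup at_infinity (\<lambda>u :: 'a::euclidean_space. ereal (norm u powr p * \<bar>ridge_kernel k u\<bar>)) > 0"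
proof (rule ccontr)
  assume "\<not> ?thesis"
  hence "Limsup at_infinity (\<lambda>u :: 'a. ereal (norm u powr p * \<bar>ridge_kernel k u\<bar>)) < 1"
    by (auto simp: not_less intro: le_less_trans)
  hence "\<forall>\<^sub>F u :: 'a in at_infinity. ereal (norm u powr p * \<bar>ridge_kernel k u\<bar>) < 1"
    by (rule Limsup_lessD)
  then obtain b where b: "\<And>u :: 'a. b \<le> norm u \<Longrightarrow> norm u powr p * \<bar>ridge_kernel k u\<bar> < 1"
    by (auto simp: eventually_at_infinity one_ereal_def)
  obtain n :: nat where n: "real n > max 1 (b ^ 2)" using reals_Archimedean2 by blast
  obtain u :: 'a where u: "u \<bullet> u = real n * pi" by (rule ridge_vector)
  have "real n * 1 \<le> real n * pi" using pi_gt3 by (intro mult_left_mono) auto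
  hence "real n \<le> norm u ^ 2" by (simp add: power2_norm_eq_inner u)
  hence big: "1 \<le> norm u ^ 2" "b ^ 2 \<le> norm u ^ 2" using n by auto
  have "1 \<le> norm u" using big(1) by (intro power2_le_imp_le[of 1 "norm u"]) auto
  moreover have "b \<le> norm u" by (rule power2_le_imp_le[OF big(2)]) auto
  ultimately show False
    using b[of u] ridge_kernel_on_ridge[OF u, of k] ge_one_powr_ge_zero[of "norm u" p] assms by simp
qed

section \<open>Eigenvalues\<close>

lemma det_of_real: "det (\<chi> i j. complex_of_real (h $ i $ j)) = of_real (det (h :: real^'n^'n))"
  by (simp add: det_def)

text \<open>
  Both sides are the modulus of the characteristic polynomial at \<open>0\<close>, once by its factorisation
  and once by its definition as a determinant.
\<close>
lemma prod_eigenvalues: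
  fixes h :: "real^'n^'n"
  shows "(\<Prod>z\<in>#eigenvalues h. cmod z) = \<bar>det h\<bar>"
proof -
  let ?A = "\<chi> i j. complex_of_real (h $ i $ j)"
  have A: "(\<chi> i j. poly ((mat [:0, 1:] - (\<chi> i j. [:?A $ i $ j:])) $ i $ j) 0) = - ?A"
    by (simp add: vec_eq_iff mat_def)
  have "poly (charpoly ?A) 0 = det (- ?A)"
    by (simp only: charpoly_def poly_det A)
  also have "\<dots> = (-1) ^ CARD('n) * det ?A"
    by (simp add: det_def prod_uminus sum_distrib_left mult.left_commute)
  finally have "cmod (poly (charpoly ?A) 0) = \<bar>det h\<bar>"
    by (simp add: det_of_real norm_mult norm_power)
  moreover have "charpoly ?A = (\<Prod>z\<in>#eigenvalues h. [:- z, 1:])"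
    using complex_poly_decompose_multiset[of "charpoly ?A"] charpoly_monic(2)[of ?A]
    by (simp add: eigenvalues_def)
  moreover have "cmod (poly (\<Prod>z\<in>#M. [:- z, 1:]) 0) = (\<Prod>z\<in>#M. cmod z)" for M
    by (induction M) (simp_all add: norm_mult)
  ultimately show ?thesis by simp
qed

text \<open>
  The eigenvector is complex, while the operator norm refers to real vectors; the real matrix acts
  separately on the real part \<open>a\<close> and the imaginary part \<open>b\<close>, and the squared norms add up.
\<close>
lemma norm_eigenvalue_le_onorm:
  fixes h :: "real^'n^'n"
  assumes "z \<in># eigenvalues h"
  shows "cmod z \<le> onorm ((*v) h)"
proof -
  let ?A = "\<chi> i j. complex_of_real (h $ i $ j)"
  obtain v :: "complex^'n" where v: "v \<noteq> 0" "?A *v v = z *s v"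
    using assms by (auto simp: eigenvalues_iff)
  define a where "a = (\<chi> i. Re (v $ i))"
  define b where "b = (\<chi> i. Im (v $ i))"
  have norm2: "norm w ^ 2 = (\<Sum>i\<in>UNIV. Re (w $ i) ^ 2) + (\<Sum>i\<in>UNIV. Im (w $ i) ^ 2)"
    for w :: "complex^'n"
    by (simp add: norm_vec_def L2_set_def sum_nonneg cmod_power2 sum.distrib)
  have norm2r: "norm w ^ 2 = (\<Sum>i\<in>UNIV. (w $ i) ^ 2)" for w :: "real^'n"
    by (simp add: norm_vec_def L2_set_def sum_nonneg)
  have nv: "norm v ^ 2 = norm a ^ 2 + norm b ^ 2"
    by (simp add: norm2 norm2r a_def b_def)
  have nhv: "norm (?A *v v) ^ 2 = norm (h *v a) ^ 2 + norm (h *v b) ^ 2"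
    by (simp add: norm2 norm2r a_def b_def matrix_vector_mult_def)
  have zv: "norm (z *s v) ^ 2 = (cmod z * norm v) ^ 2"
    by (simp add: norm_vec_def L2_set_def sum_nonneg norm_mult power_mult_distrib sum_distrib_left)
  have bl: "norm (h *v x) ^ 2 \<le> (onorm ((*v) h)) ^ 2 * norm x ^ 2" for x
    using onorm[OF matrix_vector_mul_bounded_linear, of h x]
    by (metis norm_ge_zero power_mono power_mult_distrib)
  have "(cmod z * norm v) ^ 2 = norm (h *v a) ^ 2 + norm (h *v b) ^ 2"
    by (simp only: zv[symmetric] v(2)[symmetric] nhv)
  also have "\<dots> \<le> (onorm ((*v) h) * norm v) ^ 2"
    using bl[of a] bl[of b] by (simp add: power_mult_distrib nv distrib_left)
  finally have "(cmod z * norm v) ^ 2 \<le> (onorm ((*v) h) * norm v) ^ 2" .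
  hence "cmod z * norm v \<le> onorm ((*v) h) * norm v"
    by (rule power2_le_imp_le) (simp add: onorm_pos_le matrix_vector_mul_bounded_linear)
  thus ?thesis using v(1) by simp
qed

section \<open>Densities that put the free mass on a given set\<close>

lemma ex_density_extending_uniform:
  fixes f0 :: "real^'d \<Rightarrow> real"
  assumes f0: "f0 \<in> borel_measurable (lebesgue_on (cball 0 1))" "\<forall>u\<in>cball 0 1. 0 \<le> f0 u"
    and I: "(\<integral>\<^sup>+u. ennreal (f0 u) \<partial>lebesgue_on (cball 0 1)) = ennreal I" "0 \<le> I" "I \<le> 1"
    and U: "U \<in> lmeasurable" "0 < measure lebesgue U" "U \<inter> cball 0 1 = {}"
  obtains f where "f \<in> densities_extending f0"
    "\<And>u. u \<in> U \<Longrightarrow> f u = (1 - I) / measure lebesgue U"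
proof
  let ?B = "cball 0 1 :: (real^'d) set"
  let ?\<mu> = "measure lebesgue U"
  define f where "f u = (if u \<in> ?B then f0 u else 0) + (1 - I) / ?\<mu> * indicator U u" for u
  have meas0: "(\<lambda>u. if u \<in> ?B then f0 u else 0) \<in> borel_measurable lebesgue"
    using f0(1) by (subst borel_measurable_if) auto
  have Us: "U \<in> sets lebesgue" using U(1) by (rule fmeasurableD)
  have pos: "0 \<le> f u" for u
    using f0(2) I U by (auto simp: f_def intro!: add_nonneg_nonneg)
  have "(\<integral>\<^sup>+u. ennreal (f u) \<partial>lebesgue) = (\<integral>\<^sup>+u. ennreal (if u \<in> ?B then f0 u else 0)
      + ennreal ((1 - I) / ?\<mu>) * indicator U u \<partial>lebesgue)"
    using f0(2) I U unfolding f_def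
    by (intro nn_integral_cong, subst ennreal_plus) (auto split: split_indicator)
  also have "\<dots> = (\<integral>\<^sup>+u. ennreal (if u \<in> ?B then f0 u else 0) \<partial>lebesgue)
      + ennreal ((1 - I) / ?\<mu>) * emeasure lebesgue U"
    using meas0 Us by (subst nn_integral_add) (auto simp: nn_integral_cmult_indicator)
  also have "(\<integral>\<^sup>+u. ennreal (if u \<in> ?B then f0 u else 0) \<partial>lebesgue)
      = (\<integral>\<^sup>+u. ennreal (f0 u) * indicator ?B u \<partial>lebesgue)"
    by (intro nn_integral_cong) auto
  also have "\<dots> = ennreal I"
    using I(1) by (subst (asm) nn_integral_restrict_space) auto
  also have "emeasure lebesgue U = ennreal ?\<mu>"
    using U(1) by (simp add: emeasure_eq_measure2)
  also have "ennreal I + ennreal ((1 - I) / ?\<mu>) * ennreal ?\<mu> = ennreal (I + (1 - I) / ?\<mu> * ?\<mu>)"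
    using I U by (simp flip: ennreal_mult' ennreal_plus)
  also have "\<dots> = 1" using U by simp
  finally have "probability_density f"
    using pos meas0 Us unfolding probability_density_def f_def by auto
  moreover have "f u = f0 u" if "norm u \<le> 1" for u
    using that U(3) by (auto simp: f_def split: split_indicator)
  ultimately show "f \<in> densities_extending f0"
    by (simp add: densities_extending_def)
  show "f u = (1 - I) / ?\<mu>" if "u \<in> U" for u
    using that U(3) by (auto simp: f_def)
qed

text \<open>
  Restrict the integral to \<open>U\<close>. The upper bound \<open>C\<close> on \<open>g\<close> serves to make the integrand integrable, so
  that the convolution is not a default value.
\<close>
lemma convolve_ge:
  fixes f g :: "real^'d \<Rightarrow> real"
  assumes f: "probability_density f" "\<And>u. u \<in> U \<Longrightarrow> f u = c / measure lebesgue U"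
    and U: "U \<in> lmeasurable" "0 < measure lebesgue U"
    and g: "continuous_on UNIV g" "\<And>u. 0 \<le> g u" "\<And>u. g u \<le> C" "\<And>u. u \<in> U \<Longrightarrow> a \<le> g (- u)"
  shows "a * c \<le> convolve g f 0"
proof -
  let ?\<mu> = "measure lebesgue U"
  have fm: "f \<in> borel_measurable lebesgue" and f0: "\<And>u. 0 \<le> f u"
    and f1: "(\<integral>\<^sup>+u. ennreal (f u) \<partial>lebesgue) = 1"
    using f(1) by (auto simp: probability_density_def)
  have fi: "integrable lebesgue f"
    using fm f0 f1 by (intro integrableI_bounded) auto
  have "continuous_on UNIV (\<lambda>u. g (- u))"
    by (rule continuous_on_compose2[OF g(1)]) (auto intro: continuous_intros)
  hence gm: "(\<lambda>u. g (- u)) \<in> borel_measurable lebesgue"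
    by (intro measurable_completion) (simp add: borel_measurable_continuous_onI)
  have gi: "integrable lebesgue (\<lambda>u. g (- u) * f u)"
  proof (rule Bochner_Integration.integrable_bound)
    show "integrable lebesgue (\<lambda>u. C * f u)" using fi by simp
    show "(\<lambda>u. g (- u) * f u) \<in> borel_measurable lebesgue" using fm gm by simp
    have "norm (g (- u) * f u) \<le> norm (C * f u)" for u
    proof -
      have "\<bar>g (- u)\<bar> \<le> \<bar>C\<bar>" using g(2)[of "- u"] g(3)[of "- u"] by linarith
      thus ?thesis by (simp add: abs_mult mult_right_mono)
    qed
    thus "AE u in lebesgue. norm (g (- u) * f u) \<le> norm (C * f u)" by simp
  qed
  have "a * c = (LINT u|lebesgue. (a * (c / ?\<mu>)) * indicator U u)"
    using U by simp
  also have "\<dots> \<le> (LINT u|lebesgue. g (- u) * f u)"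
  proof (rule integral_mono)
    show "integrable lebesgue (\<lambda>u. (a * (c / ?\<mu>)) * indicator U u)"
      using U by (intro integrable_mult_right) (auto simp: integrable_indicator_iff fmeasurable_def)
    show "(a * (c / ?\<mu>)) * indicator U u \<le> g (- u) * f u" for u
    proof (cases "u \<in> U")
      case True
      thus ?thesis using mult_right_mono[OF g(4) f0[of u]] f(2) by simp
    next
      case False
      thus ?thesis using g(2)[of "- u"] f0[of u] by simp
    qed
  qed (rule gi)
  finally show ?thesis by (simp add: convolve_def)
qed

section \<open>The lower bound\<close>

text \<open>
  The point is the image under \<open>h\<close> of a vector on a ridge in an arbitrary direction \<open>v\<close>. As \<open>h *v v\<close> is
  nonzero, that image leaves the unit ball once the radius of the ridge is large enough.
\<close>
lemma ridge_meets_far_region: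
  fixes h :: "real^'d^'d"
  assumes "invertible h"
  obtains x where "1 < norm x" "ridge_kernel k (matrix_inv h *v (- x)) = 1"
proof -
  obtain v :: "real^'d" where v: "norm v = 1" using vector_choose_size[of 1] by auto
  have "matrix_inv h ** h = mat 1"
    using assms unfolding invertible_def matrix_inv_def by (metis (mono_tags, lifting) someI_ex)
  hence inv: "matrix_inv h *v (h *v w) = w" for w
    by (simp add: matrix_vector_mul_assoc)
  define t where "t = norm (h *v v)"
  have "h *v v \<noteq> 0" using inv[of v] v by auto
  hence t: "t > 0" by (simp add: t_def)
  obtain n :: nat where n: "real n > 1 / t ^ 2" using reals_Archimedean2 by blast
  define w where "w = sqrt (real n * pi) *\<^sub>R v"
  have ww: "w \<bullet> w = real n * pi"
    using v by (simp add: w_def flip: power2_norm_eq_inner)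
  have "1 * 1 < real n * t ^ 2 * pi"
    using n t pi_gt3 by (intro mult_strict_mono) (auto simp: field_simps)
  also have "\<dots> = (norm (h *v w)) ^ 2"
    by (simp add: w_def t_def matrix_vector_mult_scaleR power_mult_distrib)
  finally have "1 < norm (h *v w)"
    by (intro power2_less_imp_less[of 1]) auto
  moreover have "matrix_inv h *v (- (h *v w)) = - w"
    using inv[of w] matrix_vector_mult_scaleR[of "matrix_inv h" "-1" "h *v w"] by simp
  ultimately show ?thesis
    using that[of "h *v w"] ridge_kernel_on_ridge[of "- w" n k] ww by simp
qed

text \<open>
  The bound depends on \<open>h\<close> only through its determinant, although the set \<open>U\<close> that carries the free
  mass may be very small or far away: the height of the ridges is always the same.
\<close>
lemma ex_density_convolve_ge:
  fixes h :: "real^'d^'d" and f0 :: "real^'d \<Rightarrow> real"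
  assumes f0: "f0 \<in> borel_measurable (lebesgue_on (cball 0 1))" "\<forall>u\<in>cball 0 1. 0 \<le> f0 u"
    and I: "(\<integral>\<^sup>+u. ennreal (f0 u) \<partial>lebesgue_on (cball 0 1)) = ennreal I" "0 \<le> I" "I \<le> 1"
    and h: "invertible h"
  shows "\<exists>f\<in>densities_extending f0.
           (1 - I) / 2 / \<bar>det h\<bar> \<le> convolve (rescaled h (ridge_kernel k)) f 0"
proof -
  let ?K = "ridge_kernel k :: real^'d \<Rightarrow> real"
  have dh: "\<bar>det h\<bar> > 0" using h by (simp add: invertible_det_nz)
  have cont: "continuous_on UNIV (\<lambda>x. ?K (matrix_inv h *v x))"
    by (rule continuous_on_compose2[OF continuous_ridge_kernel])
       (auto intro: linear_continuous_on matrix_vector_mul_bounded_linear)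
  hence cont': "continuous_on UNIV (\<lambda>x. ?K (matrix_inv h *v (- x)))"
    by (rule continuous_on_compose2) (auto intro: continuous_intros)
  obtain x0 where x0: "1 < norm x0" "?K (matrix_inv h *v (- x0)) = 1"
    using ridge_meets_far_region[OF h] .
  define U where "U = {x. 1 < norm x} \<inter> ball 0 (norm x0 + 1) \<inter> {x. 1 / 2 < ?K (matrix_inv h *v (- x))}"
  have "open U"
    unfolding U_def using cont' by (intro open_Int open_Collect_less continuous_intros) auto
  moreover have "bounded U" unfolding U_def by (meson bounded_Int bounded_ball)
  ultimately have U: "U \<in> lmeasurable" by (simp add: lmeasurable_open)
  have "x0 \<in> U" using x0 by (simp add: U_def)
  hence "\<not> negligible U" using \<open>open U\<close> open_not_negligible by blast
  hence Upos: "0 < measure lebesgue U"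
    using U negligible_iff_measure zero_less_measure_iff by blast
  have "U \<inter> cball 0 1 = {}" by (auto simp: U_def)
  then obtain f where f: "f \<in> densities_extending f0"
    "\<And>u. u \<in> U \<Longrightarrow> f u = (1 - I) / measure lebesgue U"
    using ex_density_extending_uniform[OF f0 I U Upos] by blast
  have "1 / 2 / \<bar>det h\<bar> * (1 - I) \<le> convolve (rescaled h ?K) f 0"
  proof (rule convolve_ge[OF _ f(2) U Upos])
    show "probability_density f" using f(1) by (simp add: densities_extending_def)
    show "continuous_on UNIV (rescaled h ?K)"
      unfolding rescaled_def [abs_def] using cont dh by (intro continuous_intros) auto
    show "0 \<le> rescaled h ?K u" for u
      using ridge_kernel_pos[of k "matrix_inv h *v u"] by (simp add: rescaled_def)
    show "rescaled h ?K u \<le> 1 / \<bar>det h\<bar>" for u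
      unfolding rescaled_def by (intro divide_right_mono ridge_kernel_le_1) simp
    show "1 / 2 / \<bar>det h\<bar> \<le> rescaled h ?K (- u)" if "u \<in> U" for u
      using that unfolding rescaled_def U_def by (intro divide_right_mono) auto
  qed
  thus ?thesis using f(1) by (auto intro!: bexI[of _ f] simp: mult.commute)
qed

theorem theorem1:
  fixes l :: nat and p :: real
  assumes "p \<ge> 0"
  shows "\<exists>K :: real^'d \<Rightarrow> real.
    kernel K \<and> radial K \<and> infinitely_differentiable K \<and>
    (\<forall>j\<le>l. integrable lebesgue (\<lambda>u. norm u ^ j * \<bar>K u\<bar>)) \<and>
    Limsup at_infinity (\<lambda>u. ereal (norm u powr p * \<bar>K u\<bar>)) > 0 \<and>
    (\<forall>f0 :: real^'d \<Rightarrow> real.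
      f0 \<in> borel_measurable (lebesgue_on (cball 0 1)) \<and>
      (\<forall>u\<in>cball 0 1. 0 \<le> f0 u) \<and>
      (\<integral>\<^sup>+u. ennreal (f0 u) \<partial>lebesgue_on (cball 0 1)) < 1 \<longrightarrow>
      (\<exists>c>0. \<exists>\<eta>>0. \<forall>h :: real^'d^'d. \<forall>lam :: complex list.
        invertible h \<and> onorm ((*v) h) \<le> \<eta> \<and>
        mset lam = eigenvalues h \<and> sorted_wrt (\<lambda>x y. cmod x \<ge> cmod y) lam \<longrightarrow>
        (SUP f \<in> densities_extending f0. ereal (convolve (rescaled h K) f 0))
          \<ge> ereal (c * (cmod (lam ! 0) powr p / (\<Prod>i<CARD('d). cmod (lam ! i))))))"
proof -
  define k where "k = l + DIM(real^'d) + 2"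
  let ?K = "ridge_kernel k :: real^'d \<Rightarrow> real"
  have abs_K: "\<bar>?K u\<bar> = ?K u" for u using ridge_kernel_pos[of k u] by simp
  have moments: "integrable lebesgue (\<lambda>u. norm u ^ j * ?K u)" if "j \<le> l" for j
    unfolding k_def using that by (rule ridge_kernel_moments)
  have radial: "radial ?K"
    unfolding radial_def ridge_kernel_def
    by (rule exI[of _ "\<lambda>r. inverse (1 + (1 + r ^ 2) ^ (3 * k) * sin (r ^ 2) ^ 2)"])
       (simp add: power2_norm_eq_inner)
  have bound: "\<exists>c>0. \<exists>\<eta>>0. \<forall>h :: real^'d^'d. \<forall>lam :: complex list.
        invertible h \<and> onorm ((*v) h) \<le> \<eta> \<and>
        mset lam = eigenvalues h \<and> sorted_wrt (\<lambda>x y. cmod x \<ge> cmod y) lam \<longrightarrow>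
        (SUP f \<in> densities_extending f0. ereal (convolve (rescaled h ?K) f 0))
          \<ge> ereal (c * (cmod (lam ! 0) powr p / (\<Prod>i<CARD('d). cmod (lam ! i))))"
    if f0: "f0 \<in> borel_measurable (lebesgue_on (cball 0 1))" "\<forall>u\<in>cball 0 1. 0 \<le> f0 u"
      and less: "(\<integral>\<^sup>+u. ennreal (f0 u) \<partial>lebesgue_on (cball 0 1)) < 1" for f0 :: "real^'d \<Rightarrow> real"
  proof -
    obtain I where I: "(\<integral>\<^sup>+u. ennreal (f0 u) \<partial>lebesgue_on (cball 0 1)) = ennreal I" "0 \<le> I" "I < 1"
      using less by (cases "\<integral>\<^sup>+u. ennreal (f0 u) \<partial>lebesgue_on (cball 0 1)") auto
    have "ereal ((1 - I) / 2 * (cmod (lam ! 0) powr p / (\<Prod>i<CARD('d). cmod (lam ! i))))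
          \<le> (SUP f \<in> densities_extending f0. ereal (convolve (rescaled h ?K) f 0))"
      if h: "invertible h" and small: "onorm ((*v) h) \<le> 1" and lam: "mset lam = eigenvalues h"
      for h :: "real^'d^'d" and lam
    proof -
      have len: "length lam = CARD('d)"
        using lam size_eigenvalues[of h] by (metis size_mset)
      hence "lam ! 0 \<in># eigenvalues h" by (simp flip: lam)
      hence "cmod (lam ! 0) \<le> 1" using norm_eigenvalue_le_onorm small by fastforce
      hence le1: "cmod (lam ! 0) powr p \<le> 1" using assms by (intro powr_le1) auto
      have "(\<Prod>i<CARD('d). cmod (lam ! i)) = prod_list (map cmod lam)"
        using len by (simp add: prod.list_conv_set_nth lessThan_atLeast0)
      also have "\<dots> = \<bar>det h\<bar>"
        using prod_eigenvalues[of h] by (simp add: prod_mset_prod_list flip: lam mset_map)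
      finally have det: "(\<Prod>i<CARD('d). cmod (lam ! i)) = \<bar>det h\<bar>" .
      have "ereal ((1 - I) / 2 * (cmod (lam ! 0) powr p / (\<Prod>i<CARD('d). cmod (lam ! i))))
          \<le> ereal ((1 - I) / 2 / \<bar>det h\<bar>)"
        using mult_left_mono[OF divide_right_mono[OF le1, of "\<bar>det h\<bar>"], of "(1 - I) / 2"] I
        by (simp add: det)
      also have "\<dots> \<le> (SUP f \<in> densities_extending f0. ereal (convolve (rescaled h ?K) f 0))"
        using ex_density_convolve_ge[OF f0 I(1,2) _ h, of k] I
        by (meson SUP_upper2 ereal_less_eq(3) less_imp_le)
      finally show ?thesis .
    qed
    with I show ?thesis
      by (intro exI[of _ "(1 - I) / 2"] exI[of _ 1] conjI) auto
  qed
  show ?thesis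
  proof (intro exI[of _ ?K] conjI)
    show "kernel ?K" using moments[of 0] by (simp add: kernel_def)
    show "\<forall>j\<le>l. integrable lebesgue (\<lambda>u. norm u ^ j * \<bar>?K u\<bar>)"
      using moments by (simp add: abs_K)
    show "radial ?K" by (rule radial)
    show "infinitely_differentiable ?K" by (rule smooth_ridge_kernel)
    show "Limsup at_infinity (\<lambda>u. ereal (norm u powr p * \<bar>?K u\<bar>)) > 0"
      by (rule Limsup_ridge_kernel_pos[OF assms])
  qed (intro allI impI, elim conjE, rule bound)
qed

end
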